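(* Let $\mathcal{A}$ be an alphabet (a finite set) and let $(a_n)_{n\ge 0}$ be an automatic sequence taking values in $\mathcal{A}$. Then $(a_n)_{n\ge 0}$ is also non-uniformly morphic; that is, there exist an alphabet $\mathcal{C}$, a non-uniform morphism $\psi$ of $\mathcal{C}^*$, an iterative fixed point $(c_n)_{n\ge 0}$ of $\psi$ in which every letter of $\mathcal{C}$ occurs, and a coding from $\mathcal{C}^*$ to $\mathcal{A}^*$ that sends $(c_n)_{n\ge 0}$ to $(a_n)_{n\ge 0}$. Furthermore, if $(a_n)_{n\ge 0}$ is the iterative fixed point of a uniform morphism of $\mathcal{A}^*$, then there exist an alphabet $\mathcal{B}$ of cardinality $3+\#\mathcal{A}$ and a sequence $(a'_n)_{n\ge 0}$ with values in $\mathcal{B}$, in which every letter of $\mathcal{B}$ occurs, such that $(a'_n)_{n\ge 0}$ is the iterative fixed point of some non-uniform morphism of $\mathcal{B}^*$, and $(a_n)_{n\ge 0}$ is the image of $(a'_n)_{n\ge 0}$ under a coding from $\mathcal{B}^*$ to $\mathcal{A}^*$.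
   Context: An alphabet is a finite set. For an alphabet $\mathcal{A}$, $\mathcal{A}^*$ is the free monoid of all finite words over $\mathcal{A}$ (including the empty word $\epsilon$) under concatenation, and $|w|$ is the length of the word $w$. Sequences $(a_n)_{n\ge 0}$ are infinite. A morphism from $\mathcal{A}^*$ to $\mathcal{B}^*$ is a map $\varphi$ with $\varphi(uv)=\varphi(u)\varphi(v)$ for all words $u,v$ (images of letters may be empty); a morphism of $\mathcal{A}^*$ is a morphism from $\mathcal{A}^*$ to itself. For an integer $k\ge 1$, $\varphi$ is $k$-uniform if $|\varphi(a)|=k$ for all $a\in\mathcal{A}$. A morphism is uniform if it is $k$-uniform for some $k\ge 1$, and non-uniform otherwise. A coding is a $1$-uniform morphism; it acts on infinite sequences letter by letter. A sequence $(a_n)_{n\ge 0}$ over $\mathcal{A}$ is an iterative fixed point of a morphism $\varphi$ of $\mathcal{A}^*$ (and is then called pure morphic) if: (i) there is a word $x\in\mathcal{A}^*$ with $\varphi(a_0)=a_0x$; (ii) $\varphi^{\ell}(x)\ne\epsilon$ for every integer $\ell\ge 0$; (iii) the words $\varphi^{\ell}(a_0)$ converge to $(a_n)_{n\ge 0}$ as $\ell\to\infty$, meaning that the length of the longest prefix of $\varphi^{\ell}(a_0)$ that is also a prefix of $(a_n)_{n\ge 0}$ tends to infinity with $\ell$. A sequence over $\mathcal{A}$ is $k$-automatic if it is the image, under a coding from some $\mathcal{D}^*$ to $\mathcal{A}^*$ ($\mathcal{D}$ an alphabet), of an iterative fixed point of a $k$-uniform morphism of $\mathcal{D}^*$. It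 is automatic if it is $k$-automatic for some $k$. (Condition (ii) with $\ell=0$ forces $k\ge 2$.) A sequence is non-uniformly pure morphic if it is the iterative fixed point of a non-uniform morphism, with the convention that the alphabet on which the non-uniform morphism is defined equals the minimal alphabet of the fixed point, i.e. every letter of that alphabet occurs in the fixed point. A sequence is non-uniformly morphic if it is the image under a coding of a non-uniformly pure morphic sequence. *)

theory Defs
  imports Complex_Main "HOL-Library.Sublist" "HOL-Library.FuncSet"
begin

(* An alphabet is a finite set A, the free monoid over it is lists A, and an infinite sequence is a
   function on nat.  Morphisms are maps on words; their values outside lists A are irrelevant. *)

definition word_morphism :: "'a set \<Rightarrow> 'b set \<Rightarrow> ('a list \<Rightarrow> 'b list) \<Rightarrow> bool" where
  "word_morphism A B \<phi> \<longleftrightarrow>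
     \<phi> \<in> lists A \<rightarrow> lists B \<and>
     (\<forall>u\<in>lists A. \<forall>v\<in>lists A. \<phi> (u @ v) = \<phi> u @ \<phi> v)"

definition k_uniform :: "nat \<Rightarrow> 'a set \<Rightarrow> ('a list \<Rightarrow> 'b list) \<Rightarrow> bool" where
  "k_uniform k A \<phi> \<longleftrightarrow> k \<ge> 1 \<and> (\<forall>a\<in>A. length (\<phi> [a]) = k)"

definition uniform_morphism :: "'a set \<Rightarrow> ('a list \<Rightarrow> 'b list) \<Rightarrow> bool" where
  "uniform_morphism A \<phi> \<longleftrightarrow> (\<exists>k. k_uniform k A \<phi>)"

definition coding :: "'a set \<Rightarrow> 'b set \<Rightarrow> ('a list \<Rightarrow> 'b list) \<Rightarrow> bool" where
  "coding A B \<tau> \<longleftrightarrow> word_morphism A B \<tau> \<and> k_uniform 1 A \<tau>"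

(* Only used for codings, where the image of a letter is a one-letter word. *)
definition coding_image :: "('a list \<Rightarrow> 'b list) \<Rightarrow> (nat \<Rightarrow> 'a) \<Rightarrow> (nat \<Rightarrow> 'b)" where
  "coding_image \<tau> a = (\<lambda>n. hd (\<tau> [a n]))"

(* The set is finite and contains 0, so the maximum is the length of the longest prefix of w
   that is also a prefix of the sequence. *)
definition common_prefix_length :: "'a list \<Rightarrow> (nat \<Rightarrow> 'a) \<Rightarrow> nat" where
  "common_prefix_length w a = Max {m. prefix (map a [0..<m]) w}"

definition iterative_fixed_point ::
    "'a set \<Rightarrow> ('a list \<Rightarrow> 'a list) \<Rightarrow> (nat \<Rightarrow> 'a) \<Rightarrow> bool" where
  "iterative_fixed_point A \<phi> a \<longleftrightarrow>
     word_morphism A A \<phi> \<and> (\<forall>n. a n \<in> A) \<and>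
     (\<exists>x\<in>lists A. \<phi> [a 0] = a 0 # x \<and> (\<forall>l. (\<phi> ^^ l) x \<noteq> [])) \<and>
     filterlim (\<lambda>l. common_prefix_length ((\<phi> ^^ l) [a 0]) a) at_top sequentially"

(* Auxiliary alphabets are taken to be finite sets of natural numbers; since every finite set is in
   bijection with such a set, this is no restriction. *)

definition k_automatic :: "nat \<Rightarrow> 'a set \<Rightarrow> (nat \<Rightarrow> 'a) \<Rightarrow> bool" where
  "k_automatic k A a \<longleftrightarrow>
     (\<exists>(D :: nat set) \<phi> d \<tau>. finite D \<and> k_uniform k D \<phi> \<and> iterative_fixed_point D \<phi> d \<and>
        coding D A \<tau> \<and> a = coding_image \<tau> d)"

definition automatic :: "'a set \<Rightarrow> (nat \<Rightarrow> 'a) \<Rightarrow> bool" where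
  "automatic A a \<longleftrightarrow> (\<exists>k. k_automatic k A a)"

(* The condition range c = C expresses that every letter of C occurs in c. *)
definition non_uniformly_pure_morphic :: "'c set \<Rightarrow> (nat \<Rightarrow> 'c) \<Rightarrow> bool" where
  "non_uniformly_pure_morphic C c \<longleftrightarrow>
     finite C \<and> range c = C \<and>
     (\<exists>\<psi>. iterative_fixed_point C \<psi> c \<and> \<not> uniform_morphism C \<psi>)"

definition non_uniformly_morphic :: "'a set \<Rightarrow> (nat \<Rightarrow> 'a) \<Rightarrow> bool" where
  "non_uniformly_morphic A a \<longleftrightarrow>
     (\<exists>(C :: nat set) c \<tau>. non_uniformly_pure_morphic C c \<and> coding C A \<tau> \<and> a = coding_image \<tau> c)"

end

theory Submission imports Defs begin

text \<open>A fixed point \<open>a\<close> of a \<open>k\<close>-uniform morphism is characterised by the fact that the block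
  of \<open>a\<close> at positions \<open>k n, ..., k n + k - 1\<close> depends only on the letter \<open>a n\<close>; this property passes
  from \<open>k\<close> to its powers \<open>K\<close>. Replace the letters of \<open>a\<close> at positions \<open>0, ..., m\<close> by pairwise distinct
  fresh letters, where \<open>m \<ge> 2\<close>, and choose \<open>K \<ge> m + 2\<close>. Each fresh letter occurs only once, so its
  image may be chosen freely: moving the boundary between the images of the letters at
  positions 1 and 2 by one place gives a non-uniform morphism that fixes the new sequence. The number
  of letters of the new sequence, \<open>m + 1\<close> plus the number of letters of \<open>a\<close> beyond
  position \<open>m\<close>, is at most \<open>3 + #A\<close> for \<open>m = 2\<close>, is unbounded in \<open>m\<close>, and grows by at most one when
  \<open>m\<close> does, so it takes every value from \<open>3 + #A\<close> on.\<close>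

section \<open>Sequences fixed by a morphism\<close>

lemma word_morphism_Nil:
  assumes "word_morphism A B \<phi>"
  shows "\<phi> [] = []"
proof -
  have "\<phi> ([] @ []) = \<phi> [] @ \<phi> []"
    using assms unfolding word_morphism_def by blast
  then show ?thesis by simp
qed

lemma word_morphism_append:
  assumes "word_morphism A B \<phi>" "u \<in> lists A" "v \<in> lists A"
  shows "\<phi> (u @ v) = \<phi> u @ \<phi> v"
  using assms unfolding word_morphism_def by blast

lemma word_morphism_in_lists:
  assumes "word_morphism A B \<phi>" "u \<in> lists A"
  shows "\<phi> u \<in> lists B"
  using assms unfolding word_morphism_def by blast

lemma map_in_lists:
  assumes "\<And>n. a n \<in> A"
  shows "map a ns \<in> lists A"
  using assms by (induction ns) auto

lemma word_morphism_funpow_in_lists: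
  assumes "word_morphism A A \<phi>" "u \<in> lists A"
  shows "(\<phi> ^^ l) u \<in> lists A"
  using assms by (induction l) (auto simp: word_morphism_in_lists)

lemma word_morphism_prefix:
  assumes "word_morphism A B \<phi>" "prefix u v" "v \<in> lists A"
  shows "prefix (\<phi> u) (\<phi> v)"
proof -
  obtain w where w: "v = u @ w" using assms(2) by (auto elim: prefixE)
  with assms(3) have "u \<in> lists A" "w \<in> lists A" by auto
  then show ?thesis using word_morphism_append[OF assms(1)] w by simp
qed

lemma word_morphism_length:
  assumes "word_morphism A B \<phi>" "k_uniform k A \<phi>" "u \<in> lists A"
  shows "length (\<phi> u) = k * length u"
  using assms(3)
proof (induction u)
  case Nil
  then show ?case using word_morphism_Nil[OF assms(1)] by simp
next
  case (Cons x u)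
  then have x: "x \<in> A" and u: "u \<in> lists A" by auto
  have "\<phi> ([x] @ u) = \<phi> [x] @ \<phi> u"
    by (rule word_morphism_append[OF assms(1)]) (use x u in auto)
  then show ?case using Cons.IH assms(2) x unfolding k_uniform_def by simp
qed

lemma finite_common_prefixes: "finite {m. prefix (map a [0..<m]) w}"
proof (rule finite_subset)
  show "{m. prefix (map a [0..<m]) w} \<subseteq> {..length w}"
    by (auto dest: prefix_length_le)
qed simp

lemma prefix_common_prefix_length:
  "prefix (map a [0..<common_prefix_length w a]) w"
proof -
  have "{m. prefix (map a [0..<m]) w} \<noteq> {}"
    by (auto intro: exI[of _ 0])
  from Max_in[OF finite_common_prefixes this] show ?thesis
    unfolding common_prefix_length_def by simp
qed

lemma common_prefix_length_map: "common_prefix_length (map a [0..<n]) a = n"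
  unfolding common_prefix_length_def
proof (rule Max_eqI[OF finite_common_prefixes])
  show "m \<le> n" if "m \<in> {m. prefix (map a [0..<m]) (map a [0..<n])}" for m
    using that by (auto dest: prefix_length_le)
qed simp

lemma prefix_map_upt:
  assumes "i \<le> j"
  shows "prefix (map a [0..<i]) (map a [0..<j])"
proof -
  obtain d where "j = i + d" using assms le_Suc_ex by blast
  then show ?thesis using upt_add_eq_append[of 0 i d] by simp
qed

lemma eventually_prefix_iterate:
  assumes "iterative_fixed_point A \<phi> a"
  shows "\<forall>\<^sub>F l in sequentially. prefix (map a [0..<n]) ((\<phi> ^^ l) [a 0])"
proof -
  have "\<forall>\<^sub>F l in sequentially. n \<le> common_prefix_length ((\<phi> ^^ l) [a 0]) a"
    using assms unfolding iterative_fixed_point_def filterlim_at_top by blast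
  then show ?thesis
    by eventually_elim
      (use prefix_map_upt prefix_common_prefix_length prefix_order.order_trans in blast)
qed

text \<open>For large \<open>l\<close>, the prefix of length \<open>n\<close> lies in the
  \<open>l\<close>-th iterate, so its image, of length \<open>k * n\<close>, is a prefix of the next
  iterate. So is the prefix of \<open>a\<close> of that length, and prefixes of one word with equal
  length coincide.\<close>

lemma uniform_fixed_point_prefix:
  assumes a: "iterative_fixed_point A \<phi> a" and k: "k_uniform k A \<phi>"
  shows "\<phi> (map a [0..<n]) = map a [0..<k * n]"
proof -
  have \<phi>: "word_morphism A A \<phi>" and aA: "\<And>n. a n \<in> A"
    using a unfolding iterative_fixed_point_def by auto
  have "\<forall>\<^sub>F l in sequentially. prefix (map a [0..<n]) ((\<phi> ^^ l) [a 0]) \<and>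
          prefix (map a [0..<k * n]) ((\<phi> ^^ Suc l) [a 0])"
    by (intro eventually_conj eventually_prefix_iterate[OF a]
        eventually_sequentially_Suc[THEN iffD2])
  then obtain l where l: "prefix (map a [0..<n]) ((\<phi> ^^ l) [a 0])"
      "prefix (map a [0..<k * n]) ((\<phi> ^^ Suc l) [a 0])"
    by (auto simp: eventually_sequentially)
  have "(\<phi> ^^ l) [a 0] \<in> lists A"
    using word_morphism_funpow_in_lists[OF \<phi>] aA by simp
  from word_morphism_prefix[OF \<phi> l(1) this]
  have 1: "prefix (\<phi> (map a [0..<n])) ((\<phi> ^^ Suc l) [a 0])" by simp
  have "length (\<phi> (map a [0..<n])) = k * n"
    using word_morphism_length[OF \<phi> k map_in_lists[of a, OF aA]] by simp
  with 1 l(2) show ?thesis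
    by (metis length_map length_upt diff_zero prefix_length_prefix prefix_order.antisym order_refl)
qed

lemma uniform_fixed_point_block:
  assumes a: "iterative_fixed_point A \<phi> a" and k: "k_uniform k A \<phi>"
  shows "\<phi> [a n] = map a [k * n..<k * Suc n]"
proof -
  have \<phi>: "word_morphism A A \<phi>" and aA: "\<And>n. a n \<in> A"
    using a unfolding iterative_fixed_point_def by auto
  have "map a [0..<k * n] @ map a [k * n..<k * Suc n] = map a [0..<k * Suc n]"
    using upt_add_eq_append[of 0 "k * n" k] by (simp add: add.commute)
  also have "\<dots> = \<phi> (map a [0..<n] @ [a n])"
    using uniform_fixed_point_prefix[OF a k, of "Suc n"] by simp
  also have "\<dots> = map a [0..<k * n] @ \<phi> [a n]"
    using word_morphism_append[OF \<phi> map_in_lists[of a, OF aA], of "[a n]"] aA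
      uniform_fixed_point_prefix[OF a k, of n] by simp
  finally show ?thesis by simp
qed

lemma uniform_fixed_point_ge_2:
  assumes "iterative_fixed_point A \<phi> a" and "k_uniform k A \<phi>"
  shows "2 \<le> k"
proof -
  obtain x where x: "\<phi> [a 0] = a 0 # x" "\<forall>l. (\<phi> ^^ l) x \<noteq> []" and a0: "a 0 \<in> A"
    using assms unfolding iterative_fixed_point_def by auto
  from x(2)[rule_format, of 0] have "x \<noteq> []" by simp
  moreover have "length (a 0 # x) = k"
    using x(1) a0 assms(2) unfolding k_uniform_def by auto
  ultimately show ?thesis by (cases x) auto
qed

text \<open>This keeps from a \<open>k\<close>-uniform morphism only what is visible in the
  sequence, so that passing to powers of \<open>k\<close> requires no iterated morphism.\<close>

definition block_determined :: "nat \<Rightarrow> (nat \<Rightarrow> 'a) \<Rightarrow> bool" where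
  "block_determined k a \<longleftrightarrow> (\<forall>n n'. a n = a n' \<longrightarrow> (\<forall>j<k. a (k * n + j) = a (k * n' + j)))"

lemma block_determinedD:
  assumes "block_determined k a" "a n = a n'" "j < k"
  shows "a (k * n + j) = a (k * n' + j)"
  using assms unfolding block_determined_def by blast

text \<open>A block of length \<open>k * l\<close> is the concatenation of the
  \<open>k\<close>-blocks of the \<open>l\<close> letters in an \<open>l\<close>-block. Equal
  letters have equal \<open>l\<close>-blocks, whose letters in turn have equal
  \<open>k\<close>-blocks.\<close>

lemma block_determined_mult:
  assumes k: "block_determined k a" and l: "block_determined l a"
  shows "block_determined (k * l) a"
  unfolding block_determined_def
proof (intro allI impI)
  fix n n' j assume n: "a n = a n'" and j: "j < k * l"
  then have "0 < k" by (cases k) auto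
  have jk: "j div k < l" using j \<open>0 < k\<close> by (simp add: less_mult_imp_div_less mult.commute)
  have *: "k * l * i + j = k * (l * i + j div k) + j mod k" for i
    by (simp add: algebra_simps)
  show "a (k * l * n + j) = a (k * l * n' + j)"
    unfolding * using block_determinedD[OF l n jk] \<open>0 < k\<close>
    by (intro block_determinedD[OF k]) auto
qed

lemma block_determined_power:
  assumes "block_determined k a"
  shows "block_determined (k ^ t) a"
proof (induction t)
  case 0
  then show ?case by (simp add: block_determined_def)
next
  case (Suc t)
  then show ?case using block_determined_mult[OF assms] by simp
qed

lemma uniform_fixed_point_block_determined:
  assumes "iterative_fixed_point A \<phi> a" "k_uniform k A \<phi>"
  shows "block_determined k a"
  unfolding block_determined_def
proof (intro allI impI)
  fix n n' j assume "a n = a n'" and j: "j < k"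
  then have "map a [k * n..<k * Suc n] ! j = map a [k * n'..<k * Suc n'] ! j"
    using uniform_fixed_point_block[OF assms] by metis
  then show "a (k * n + j) = a (k * n' + j)" using j by simp
qed

section \<open>Morphisms from cut sequences\<close>

text \<open>The cut \<open>s n\<close> is the position in \<open>c\<close> where the image of the
  letter \<open>c n\<close> starts. \<open>SOME\<close> picks an arbitrary occurrence of the letter;
  \<open>block_cong\<close> below makes the choice irrelevant.\<close>

definition cut_morphism :: "(nat \<Rightarrow> nat) \<Rightarrow> (nat \<Rightarrow> 'c) \<Rightarrow> 'c list \<Rightarrow> 'c list" where
  "cut_morphism s c w =
     concat (map (\<lambda>x. let n = (SOME n. c n = x) in map c [s n..<s (Suc n)]) w)"

locale cut_sequence =
  fixes s :: "nat \<Rightarrow> nat" and c :: "nat \<Rightarrow> 'c"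
  assumes s_0: "s 0 = 0" and s_1: "1 < s 1" and s_mono: "strict_mono s"
    and block_cong: "c n = c n' \<Longrightarrow> map c [s n..<s (Suc n)] = map c [s n'..<s (Suc n')]"
begin

lemma cut_morphism_letter: "cut_morphism s c [c n] = map c [s n..<s (Suc n)]"
proof -
  have "c (SOME i. c i = c n) = c n" by (rule someI) (rule refl)
  then show ?thesis unfolding cut_morphism_def Let_def using block_cong[of "SOME i. c i = c n" n] by simp
qed

text \<open>Images of consecutive letters are adjacent in \<open>c\<close>, so they telescope.
  Iterating the morphism thus amounts to iterating \<open>s\<close> on the end points of a
  factor.\<close>

lemma cut_morphism_upt:
  assumes "i \<le> j"
  shows "cut_morphism s c (map c [i..<j]) = map c [s i..<s j]"
  using assms
proof (induction j rule: dec_induct)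
  case base
  then show ?case by (simp add: cut_morphism_def)
next
  case (step j)
  have "cut_morphism s c (map c [i..<Suc j]) =
      cut_morphism s c (map c [i..<j]) @ cut_morphism s c [c j]"
    using step.hyps by (simp add: cut_morphism_def)
  also have "\<dots> = map c ([s i..<s j] @ [s j..<s (Suc j)])"
    using step.IH cut_morphism_letter by simp
  also have "[s i..<s j] @ [s j..<s (Suc j)] = [s i..<s (Suc j)]"
    using upt_add_eq_append[of "s i" "s j" "s (Suc j) - s j"] step.hyps s_mono
    by (simp add: strict_mono_less_eq)
  finally show ?case .
qed

lemma funpow_strict_mono: "strict_mono (s ^^ l)"
  using s_mono by (induction l) (auto simp: strict_mono_def)

lemma cut_morphism_funpow_upt:
  assumes "i \<le> j"
  shows "(cut_morphism s c ^^ l) (map c [i..<j]) = map c [(s ^^ l) i..<(s ^^ l) j]"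
  by (induction l) (use assms funpow_strict_mono in \<open>auto simp: cut_morphism_upt strict_mono_less_eq\<close>)

text \<open>Since \<open>s 0 = 0\<close>, the iterates on the first letter are prefixes of
  \<open>c\<close> of length \<open>(s ^^ l) 1\<close>. From \<open>1 < s 1\<close> and
  monotonicity, these lengths increase strictly and the iterates on the remainder of the first image
  never become empty.\<close>

lemma iterative_fixed_point_cut_morphism:
  "iterative_fixed_point (range c) (cut_morphism s c) c"
  unfolding iterative_fixed_point_def
proof (intro conjI)
  show "word_morphism (range c) (range c) (cut_morphism s c)"
    unfolding word_morphism_def by (auto simp: cut_morphism_def Let_def)
next
  show "\<exists>x\<in>lists (range c). cut_morphism s c [c 0] = c 0 # x \<and> (\<forall>l. (cut_morphism s c ^^ l) x \<noteq> [])"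
  proof (intro bexI conjI allI)
    show "cut_morphism s c [c 0] = c 0 # map c [1..<s 1]"
      using cut_morphism_letter[of 0] s_0 s_1 by (simp add: upt_conv_Cons)
    show "(cut_morphism s c ^^ l) (map c [1..<s 1]) \<noteq> []" for l
      using cut_morphism_funpow_upt[of 1 "s 1" l] strict_monoD[OF funpow_strict_mono s_1, of l] s_1
      by simp
  qed auto
next
  have iter: "(cut_morphism s c ^^ l) [c 0] = map c [0..<(s ^^ l) 1]" for l
  proof -
    have "(s ^^ l) 0 = 0" by (induction l) (auto simp: s_0)
    then show ?thesis using cut_morphism_funpow_upt[of 0 1 l] by simp
  qed
  have "strict_mono (\<lambda>l. (s ^^ l) 1)"
    unfolding strict_mono_Suc_iff
    using strict_monoD[OF funpow_strict_mono s_1] by (simp add: funpow_swap1)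
  then show "filterlim (\<lambda>l. common_prefix_length ((cut_morphism s c ^^ l) [c 0]) c) at_top sequentially"
    unfolding iter common_prefix_length_map by (rule filterlim_subseq)
qed auto

end

section \<open>Marking an initial segment\<close>

lemma card_marked_alphabet:
  fixes a :: "nat \<Rightarrow> 'a"
  assumes A: "finite A" "range a \<subseteq> A" and N: "3 + card A \<le> N"
  obtains m where "2 \<le> m" "Suc m + card (a ` {m<..}) = N"
proof -
  define f where "f m = Suc m + card (a ` {m<..})" for m
  have fin: "finite (a ` S)" for S using A by (meson finite_subset image_mono subset_UNIV)
  have f_Suc: "f (Suc m) \<le> Suc (f m)" for m
    unfolding f_def using card_mono[OF fin, of "a ` {Suc m<..}" "{m<..}"] by (simp add: image_mono)
  have "card (a ` {2<..}) \<le> card A" using A by (intro card_mono) auto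
  then have f_2: "f 2 \<le> N" using N by (simp add: f_def)
  \<comment> \<open>Discrete intermediate value argument: otherwise \<open>f\<close> would stay at
    or below \<open>N\<close> from 2 on, against \<open>f N > N\<close>.\<close>
  have "\<exists>m\<ge>2. f m \<le> N \<and> N < f (Suc m)"
  proof (rule ccontr)
    assume no: "\<not> ?thesis"
    have "f m \<le> N" if "2 \<le> m" for m
      using that by (induction m rule: dec_induct) (use f_2 no in \<open>auto simp: not_less\<close>)
    from this[of N] N show False by (simp add: f_def)
  qed
  then obtain m where m: "2 \<le> m" "f m \<le> N" "N < f (Suc m)" by blast
  with f_Suc[of m] have "f m = N" by simp
  with m(1) that show ?thesis by (simp add: f_def)
qed

text \<open>This serves both halves of the theorem: it applies to \<open>a\<close> itself, and to
  the uniform fixed point of which an automatic sequence is a coding.\<close>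

lemma uniform_fixed_point_image_of_non_uniform:
  fixes a :: "nat \<Rightarrow> 'a"
  assumes A: "finite A" and a: "iterative_fixed_point A \<phi> a"
    and \<phi>: "uniform_morphism A \<phi>" and N: "3 + card A \<le> N"
  shows "\<exists>(B :: nat set) a' \<tau>. card B = N \<and> non_uniformly_pure_morphic B a' \<and>
           coding B A \<tau> \<and> a = coding_image \<tau> a'"
proof -
  obtain k where k: "k_uniform k A \<phi>" using \<phi> unfolding uniform_morphism_def by blast
  have aA: "a n \<in> A" for n using a unfolding iterative_fixed_point_def by blast
  obtain m where m: "2 \<le> m" and card_m: "Suc m + card (a ` {m<..}) = N"
    using card_marked_alphabet[OF A _ N] aA by blast
  define K where "K = k ^ (m + 2)"
  have K_det: "block_determined K a"
    unfolding K_def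
    by (intro block_determined_power uniform_fixed_point_block_determined[OF a k])
  have "m + 2 < 2 ^ (m + 2)" by (rule less_exp)
  also have "(2::nat) ^ (m + 2) \<le> K"
    unfolding K_def by (rule power_mono) (use uniform_fixed_point_ge_2[OF a k] in auto)
  finally have K: "m + 2 < K" .

  obtain e :: "'a \<Rightarrow> nat" where e: "inj_on e A"
    using finite_imp_inj_to_nat_seg[OF A] by blast
  \<comment> \<open>The marks are the numbers up to \<open>m\<close>; the shift by
    \<open>Suc m\<close> keeps the codes of ordinary letters apart from them.\<close>
  define a' where "a' n = (if n \<le> m then n else Suc m + e (a n))" for n
  \<comment> \<open>The regular cuts \<open>K * n\<close> are kept except at 2, where the cut moves
    one place to the left: letter 1 gets an image of length \<open>K - 1\<close>, letter 2 one of
    length \<open>K + 1\<close>.\<close>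
  define s where "s n = (if n = 2 then 2 * K - 1 else K * n)" for n
  interpret cut_sequence s a'
  proof
    show "strict_mono s"
      unfolding strict_mono_Suc_iff
    proof
      fix n :: nat
      consider "n = 1" | "n = 2" | "n \<noteq> 1" "n \<noteq> 2" by blast
      then show "s n < s (Suc n)" by cases (use K m in \<open>auto simp: s_def\<close>)
    qed
  next
    fix n n' assume eq: "a' n = a' n'"
    show "map a' [s n..<s (Suc n)] = map a' [s n'..<s (Suc n')]"
    proof (cases "n \<le> m")
      case True
      \<comment> \<open>A marked letter occurs only once. As \<open>2 \<le> m\<close>, this covers
        both letters whose images were altered.\<close>
      with eq have "n = n'" by (auto simp: a'_def split: if_splits)
      then show ?thesis by simp
    next
      case False
      with eq have n': "\<not> n' \<le> m" by (auto simp: a'_def split: if_splits)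
      with False eq have "e (a n) = e (a n')" by (simp add: a'_def)
      then have an: "a n = a n'" using e aA by (auto dest: inj_onD)
      \<comment> \<open>Beyond \<open>m\<close> both cuts are regular, and the block starts at
        \<open>K * i \<ge> i > m\<close>. It therefore contains no mark and is governed by
        \<open>block_determined K a\<close>.\<close>
      have shift: "map a' [s i..<s (Suc i)] = map (\<lambda>j. Suc m + e (a (K * i + j))) [0..<K]"
        if i: "\<not> i \<le> m" for i
      proof (rule nth_equalityI)
        show "length (map a' [s i..<s (Suc i)]) = length (map (\<lambda>j. Suc m + e (a (K * i + j))) [0..<K])"
          using i m by (simp add: s_def)
      next
        fix j assume "j < length (map a' [s i..<s (Suc i)])"
        then have j: "j < K" using i m by (simp add: s_def)
        have "i \<le> K * i" using K by simp
        then have "\<not> K * i + j \<le> m" using i by linarith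
        with i j m show "map a' [s i..<s (Suc i)] ! j = map (\<lambda>j. Suc m + e (a (K * i + j))) [0..<K] ! j"
          by (simp add: s_def a'_def)
      qed
      show ?thesis
        unfolding shift[OF False] shift[OF n'] using block_determinedD[OF K_det an] by auto
    qed
  qed (use K in \<open>auto simp: s_def\<close>)

  have range: "range a' = {..m} \<union> (\<lambda>x. Suc m + e x) ` a ` {m<..}"
    by (force simp: a'_def image_iff)
  have fin: "finite (a ` {m<..})" using A aA by (auto intro: finite_subset)
  have "inj_on (\<lambda>x. Suc m + e x) (a ` {m<..})"
    using e aA by (auto simp: inj_on_def)
  then have card_B: "card (range a') = N"
    unfolding range using fin card_m by (subst card_Un_disjoint) (auto simp: card_image)

  have "\<not> uniform_morphism (range a') (cut_morphism s a')"
  proof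
    assume "uniform_morphism (range a') (cut_morphism s a')"
    \<comment> \<open>These two images have lengths \<open>K\<close> and
      \<open>K - 1\<close>.\<close>
    then have "length (cut_morphism s a' [a' 0]) = length (cut_morphism s a' [a' 1])"
      unfolding uniform_morphism_def k_uniform_def by (metis rangeI)
    then show False unfolding cut_morphism_letter using K by (simp add: s_def numeral_2_eq_2)
  qed
  then have pure: "non_uniformly_pure_morphic (range a') a'"
    unfolding non_uniformly_pure_morphic_def
    using iterative_fixed_point_cut_morphism fin range by auto

  \<comment> \<open>The coding back to \<open>A\<close> restores the letter hidden by each mark and
    decodes the other letters.\<close>
  define d where "d i = (if i \<le> m then a i else inv_into A e (i - Suc m))" for i
  have d: "d (a' n) = a n" for n
    using inv_into_f_f[OF e aA] by (simp add: d_def a'_def)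
  have "d b \<in> A" if "b \<in> range a'" for b using that d aA by auto
  then have "coding (range a') A (map d)"
    unfolding coding_def word_morphism_def k_uniform_def by auto
  moreover have "a = coding_image (map d) a'"
    unfolding coding_image_def using d by simp
  ultimately show ?thesis using card_B pure by blast
qed

lemma coding_comp:
  assumes \<sigma>: "coding B D \<sigma>" and \<tau>: "coding D A \<tau>"
  shows "coding B A (\<tau> \<circ> \<sigma>)"
proof -
  have "length (\<tau> (\<sigma> [b])) = 1" if "b \<in> B" for b
  proof -
    have "\<sigma> [b] \<in> lists D"
      using \<sigma> that word_morphism_in_lists[of B D \<sigma> "[b]"] unfolding coding_def by simp
    moreover have "length (\<sigma> [b]) = 1"
      using \<sigma> that unfolding coding_def k_uniform_def by blast
    ultimately show ?thesis
      using \<tau> word_morphism_length[of D A \<tau> 1 "\<sigma> [b]"] by (simp add: coding_def)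
  qed
  moreover have "word_morphism B A (\<tau> \<circ> \<sigma>)"
    unfolding word_morphism_def
  proof (intro conjI funcsetI ballI)
    have \<sigma>': "word_morphism B D \<sigma>" and \<tau>': "word_morphism D A \<tau>"
      using \<sigma> \<tau> by (simp_all add: coding_def)
    note in_D = word_morphism_in_lists[OF \<sigma>']
    show "(\<tau> \<circ> \<sigma>) u \<in> lists A" if "u \<in> lists B" for u
      unfolding comp_def by (intro word_morphism_in_lists[OF \<tau>'] in_D that)
    show "(\<tau> \<circ> \<sigma>) (u @ v) = (\<tau> \<circ> \<sigma>) u @ (\<tau> \<circ> \<sigma>) v"
      if "u \<in> lists B" "v \<in> lists B" for u v
      unfolding comp_def word_morphism_append[OF \<sigma>' that]
      by (intro word_morphism_append[OF \<tau>'] in_D that)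
  qed
  ultimately show ?thesis unfolding coding_def k_uniform_def comp_def by blast
qed

lemma coding_image_comp:
  assumes "coding B D \<sigma>" "range c \<subseteq> B"
  shows "coding_image (\<tau> \<circ> \<sigma>) c = coding_image \<tau> (coding_image \<sigma> c)"
proof
  fix n
  have "length (\<sigma> [c n]) = 1" using assms by (auto simp: coding_def k_uniform_def)
  then have "[hd (\<sigma> [c n])] = \<sigma> [c n]" by (cases "\<sigma> [c n]") auto
  then show "coding_image (\<tau> \<circ> \<sigma>) c n = coding_image \<tau> (coding_image \<sigma> c) n"
    by (simp add: coding_image_def)
qed

theorem theorem11:
  fixes A :: "'a set" and a :: "nat \<Rightarrow> 'a"
  assumes "finite A" and "automatic A a"
  shows "non_uniformly_morphic A a \<and>
    ((\<exists>\<phi>. iterative_fixed_point A \<phi> a \<and> uniform_morphism A \<phi>) \<longrightarrow>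
      (\<exists>(B :: nat set) a' \<tau>. card B = 3 + card A \<and> non_uniformly_pure_morphic B a' \<and>
         coding B A \<tau> \<and> a = coding_image \<tau> a'))"
proof
  obtain D :: "nat set" and k \<phi> d \<tau> where D: "finite D" "k_uniform k D \<phi>"
      "iterative_fixed_point D \<phi> d" and \<tau>: "coding D A \<tau>" "a = coding_image \<tau> d"
    using assms(2) unfolding automatic_def k_automatic_def by blast
  have "uniform_morphism D \<phi>" using D(2) unfolding uniform_morphism_def by blast
  \<comment> \<open>The underlying fixed point \<open>d\<close> is itself a coding of a non-uniform
    fixed point \<open>c\<close>; composing the two codings sends \<open>c\<close> to
    \<open>a\<close>.\<close>
  from uniform_fixed_point_image_of_non_uniform[OF D(1,3) this order_refl]
  obtain B :: "nat set" and c \<sigma> where c: "non_uniformly_pure_morphic B c"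
      and \<sigma>: "coding B D \<sigma>" "d = coding_image \<sigma> c"
    by blast
  have c_B: "range c \<subseteq> B" using c unfolding non_uniformly_pure_morphic_def by blast
  have "a = coding_image (\<tau> \<circ> \<sigma>) c"
    unfolding coding_image_comp[OF \<sigma>(1) c_B] \<tau>(2) \<sigma>(2) ..
  then show "non_uniformly_morphic A a"
    unfolding non_uniformly_morphic_def using c coding_comp[OF \<sigma>(1) \<tau>(1)] by blast
next
  show "(\<exists>\<phi>. iterative_fixed_point A \<phi> a \<and> uniform_morphism A \<phi>) \<longrightarrow>
      (\<exists>(B :: nat set) a' \<tau>. card B = 3 + card A \<and> non_uniformly_pure_morphic B a' \<and>
         coding B A \<tau> \<and> a = coding_image \<tau> a')"
    using uniform_fixed_point_image_of_non_uniform[OF assms(1) _ _ order_refl] by blast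
qed

end
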